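(* Suppose $X$ has continuous paths. Then the following assertions are equivalent: (i) $X$ satisfies (TWC) at a.s. finite stopping times. (ii) $X$ satisfies (TWC) at bounded stopping times. (iii) $X$ has no $0$-admissible arbitrage of the form $H\mathbf{1}_{(\sigma,\tau]}$ with bounded stopping times $\sigma\le\tau$ and an $\mathcal{F}_\sigma$-measurable direction $H$. (iv) $X$ has no $0$-admissible simple arbitrage.
   Context: Setting: $(\Omega,\mathcal{F},(\mathcal{F}_t)_{t\in[0,\infty)},P)$ is a filtered probability space satisfying the usual conditions (completeness and right-continuity), and $X=(X_t)_{t\in[0,\infty)}$ is an $(\mathcal{F}_t)$-adapted $\mathbb{R}^D$-valued process (column vectors) modelling $D$ discounted stocks; there is also a constant bond $B_t=1$. All stopping times are with respect to $(\mathcal{F}_t)$. Simple strategy: $\Phi_t=\phi_0\mathbf{1}_{\{0\}}(t)+\sum_{j=0}^{n-1}\phi_j\mathbf{1}_{(\tau_j,\tau_{j+1}]}(t)$, where $n\in\mathbb{N}$, $0=\tau_0\le\tau_1\le\cdots\le\tau_n$ are a.s. finite stopping times and each $\phi_j$ is a $D$-dimensional row vector of $\mathcal{F}_{\tau_j}$-measurable (real) random variables. Its wealth process with initial capital $v$ is $V_t(\Phi;v)=v+\sum_{j=0}^{n-1}\phi_j(X_{t\wedge\tau_{j+1}}-X_{t\wedge\tau_j})$ for $t\in[0,\infty)$, and $V_\infty(\Phi;v)=\lim_{t\to\infty}V_t(\Phi;v)=v+\sum_{j=0}^{n-1}\phi_j(X_{\tau_{j+1}}-X_{\tau_j})$.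 A simple strategy $\Phi$ is an arbitrage (simple arbitrage) if $V_\infty(\Phi;0)\ge0$ $P$-a.s. and $P(V_\infty(\Phi;0)>0)>0$; it is $0$-admissible if $\inf_{t\in[0,\infty)}V_t(\Phi;0)\ge0$ $P$-a.s. For a stopping time $\sigma$, an $\mathcal{F}_\sigma$-measurable direction is a $D$-dimensional row vector $H$ of $\mathcal{F}_\sigma$-measurable random variables with $|H|=1$ $P$-a.s. (Euclidean norm). (TWC), two-way crossing: for an a.s. finite stopping time $\sigma$ and an $\mathcal{F}_\sigma$-measurable direction $H$ let $\sigma_H=\inf\{t\ge\sigma:\ H(X_t-X_\sigma)>0\}$ (with $\inf\emptyset=\infty$). $X$ satisfies (TWC) at bounded stopping times (respectively, at a.s. finite stopping times) if $\sigma_H=\sigma_{-H}$ $P$-a.s. for every bounded (respectively, every a.s. finite) stopping time $\sigma$ and every $\mathcal{F}_\sigma$-measurable direction $H$. *)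

theory Defs
  imports "HOL-Probability.Probability"
begin

text \<open>
  Time points are nonnegative reals; stopping times take values in \<^typ>\<open>ennreal\<close>. In order to use
  the library's \<^const>\<open>stopping_time\<close> and \<^locale>\<open>filtration\<close>, the filtration is indexed by
  \<^typ>\<open>ennreal\<close> as well. The member \<open>F \<infinity>\<close> may be any \<open>\<sigma>\<close>-algebra between \<open>\<Union>t<\<infinity>. F t\<close> and \<open>M\<close>:
  the condition on a stopping time at \<open>t = \<infinity>\<close> is void, and, all null sets being in \<open>F 0\<close>, the
  \<open>\<sigma>\<close>-algebra of an almost surely finite stopping time does not depend on \<open>F \<infinity>\<close>.
\<close>

locale usual_filtered_prob_space =
  prob_space M + complete_measure M + filtration "space M" F
  for M :: "'a measure" and F :: "ennreal \<Rightarrow> 'a measure" +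
  assumes sets_F_subset: "\<And>t. sets (F t) \<subseteq> sets M"
    and null_sets_F: "null_sets M \<subseteq> sets (F 0)"
    and right_continuous_F: "\<And>t. t < \<infinity> \<Longrightarrow> sets (F t) = (\<Inter>s\<in>{t<..}. sets (F s))"

definition adapted :: "(ennreal \<Rightarrow> 'a measure) \<Rightarrow> (real \<Rightarrow> 'a \<Rightarrow> 'b::topological_space) \<Rightarrow> bool"
  where "adapted F X \<longleftrightarrow> (\<forall>t\<ge>0. X t \<in> borel_measurable (F (ennreal t)))"

definition continuous_paths :: "'a measure \<Rightarrow> (real \<Rightarrow> 'a \<Rightarrow> 'b::topological_space) \<Rightarrow> bool"
  where "continuous_paths M X \<longleftrightarrow> (\<forall>\<omega>\<in>space M. continuous_on {0..} (\<lambda>t. X t \<omega>))"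

definition finite_stopping_time ::
    "'a measure \<Rightarrow> (ennreal \<Rightarrow> 'a measure) \<Rightarrow> ('a \<Rightarrow> ennreal) \<Rightarrow> bool"
  where "finite_stopping_time M F \<sigma> \<longleftrightarrow> stopping_time F \<sigma> \<and> (AE \<omega> in M. \<sigma> \<omega> < \<infinity>)"

definition bounded_stopping_time ::
    "'a measure \<Rightarrow> (ennreal \<Rightarrow> 'a measure) \<Rightarrow> ('a \<Rightarrow> ennreal) \<Rightarrow> bool"
  where "bounded_stopping_time M F \<sigma> \<longleftrightarrow>
    stopping_time F \<sigma> \<and> (\<exists>c::real. \<forall>\<omega>\<in>space M. \<sigma> \<omega> \<le> ennreal c)"

text \<open>The value \<open>X\<^sub>s\<close>; at \<open>s = \<infinity>\<close> this is the junk value \<open>X\<^sub>0\<close>, which below only enters on null sets.\<close>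

definition at_time :: "(real \<Rightarrow> 'a \<Rightarrow> 'b) \<Rightarrow> ennreal \<Rightarrow> 'a \<Rightarrow> 'b"
  where "at_time X s \<omega> = X (enn2real s) \<omega>"

text \<open>Row and column vectors are both elements of \<^typ>\<open>real ^ 'd\<close>, and the product of a row with a
  column is the inner product; \<^const>\<open>norm\<close> is the Euclidean norm.\<close>

definition direction ::
    "'a measure \<Rightarrow> (ennreal \<Rightarrow> 'a measure) \<Rightarrow> ('a \<Rightarrow> ennreal) \<Rightarrow> ('a \<Rightarrow> real ^ 'd) \<Rightarrow> bool"
  where "direction M F \<sigma> H \<longleftrightarrow>
    H \<in> borel_measurable (filtration.pre_sigma (space M) F \<sigma>) \<and> (AE \<omega> in M. norm (H \<omega>) = 1)"

definition crossing_time ::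
    "(real \<Rightarrow> 'a \<Rightarrow> real ^ 'd) \<Rightarrow> ('a \<Rightarrow> ennreal) \<Rightarrow> ('a \<Rightarrow> real ^ 'd) \<Rightarrow> 'a \<Rightarrow> ennreal"
  where "crossing_time X \<sigma> H \<omega> =
    Inf (ennreal ` {t. 0 \<le> t \<and> \<sigma> \<omega> \<le> ennreal t \<and> H \<omega> \<bullet> (X t \<omega> - at_time X (\<sigma> \<omega>) \<omega>) > 0})"

definition two_way_crossing_at ::
    "'a measure \<Rightarrow> (ennreal \<Rightarrow> 'a measure) \<Rightarrow> (real \<Rightarrow> 'a \<Rightarrow> real ^ 'd) \<Rightarrow> ('a \<Rightarrow> ennreal) \<Rightarrow> bool"
  where "two_way_crossing_at M F X \<sigma> \<longleftrightarrow>
    (\<forall>H. direction M F \<sigma> H \<longrightarrow>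
      (AE \<omega> in M. crossing_time X \<sigma> H \<omega> = crossing_time X \<sigma> (\<lambda>\<omega>. - H \<omega>) \<omega>))"

definition TWC_finite ::
    "'a measure \<Rightarrow> (ennreal \<Rightarrow> 'a measure) \<Rightarrow> (real \<Rightarrow> 'a \<Rightarrow> real ^ 'd) \<Rightarrow> bool"
  where "TWC_finite M F X \<longleftrightarrow> (\<forall>\<sigma>. finite_stopping_time M F \<sigma> \<longrightarrow> two_way_crossing_at M F X \<sigma>)"

definition TWC_bounded ::
    "'a measure \<Rightarrow> (ennreal \<Rightarrow> 'a measure) \<Rightarrow> (real \<Rightarrow> 'a \<Rightarrow> real ^ 'd) \<Rightarrow> bool"
  where "TWC_bounded M F X \<longleftrightarrow> (\<forall>\<sigma>. bounded_stopping_time M F \<sigma> \<longrightarrow> two_way_crossing_at M F X \<sigma>)"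

text \<open>A simple strategy is given by \<open>n\<close>, the times \<open>\<tau>\<^sub>0, \<dots>, \<tau>\<^sub>n\<close> and the holdings
  \<open>\<phi>\<^sub>0, \<dots>, \<phi>\<^sub>n\<^sub>-\<^sub>1\<close>; other values of \<open>\<tau>\<close> and \<open>\<phi>\<close> are irrelevant.\<close>

definition simple_strategy ::
    "'a measure \<Rightarrow> (ennreal \<Rightarrow> 'a measure) \<Rightarrow> nat \<Rightarrow> (nat \<Rightarrow> 'a \<Rightarrow> ennreal) \<Rightarrow>
      (nat \<Rightarrow> 'a \<Rightarrow> real ^ 'd) \<Rightarrow> bool"
  where "simple_strategy M F n \<tau> \<phi> \<longleftrightarrow>
    0 < n \<and>
    (\<forall>j\<le>n. finite_stopping_time M F (\<tau> j)) \<and>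
    (\<forall>\<omega>\<in>space M. \<tau> 0 \<omega> = 0 \<and> (\<forall>j<n. \<tau> j \<omega> \<le> \<tau> (Suc j) \<omega>)) \<and>
    (\<forall>j<n. \<phi> j \<in> borel_measurable (filtration.pre_sigma (space M) F (\<tau> j)))"

definition strategy_process ::
    "nat \<Rightarrow> (nat \<Rightarrow> 'a \<Rightarrow> ennreal) \<Rightarrow> (nat \<Rightarrow> 'a \<Rightarrow> real ^ 'd) \<Rightarrow> real \<Rightarrow> 'a \<Rightarrow> real ^ 'd"
  where "strategy_process n \<tau> \<phi> t \<omega> =
    indicator {0} t *\<^sub>R \<phi> 0 \<omega> +
    (\<Sum>j<n. indicator {\<tau> j \<omega><..\<tau> (Suc j) \<omega>} (ennreal t) *\<^sub>R \<phi> j \<omega>)"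

definition wealth ::
    "(real \<Rightarrow> 'a \<Rightarrow> real ^ 'd) \<Rightarrow> nat \<Rightarrow> (nat \<Rightarrow> 'a \<Rightarrow> ennreal) \<Rightarrow> (nat \<Rightarrow> 'a \<Rightarrow> real ^ 'd) \<Rightarrow>
      real \<Rightarrow> real \<Rightarrow> 'a \<Rightarrow> real"
  where "wealth X n \<tau> \<phi> v t \<omega> =
    v + (\<Sum>j<n. \<phi> j \<omega> \<bullet>
      (at_time X (min (ennreal t) (\<tau> (Suc j) \<omega>)) \<omega> - at_time X (min (ennreal t) (\<tau> j \<omega>)) \<omega>))"

definition terminal_wealth ::
    "(real \<Rightarrow> 'a \<Rightarrow> real ^ 'd) \<Rightarrow> nat \<Rightarrow> (nat \<Rightarrow> 'a \<Rightarrow> ennreal) \<Rightarrow> (nat \<Rightarrow> 'a \<Rightarrow> real ^ 'd) \<Rightarrow>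
      real \<Rightarrow> 'a \<Rightarrow> real"
  where "terminal_wealth X n \<tau> \<phi> v \<omega> = Lim at_top (\<lambda>t. wealth X n \<tau> \<phi> v t \<omega>)"

lemma terminal_wealth_eq:
  assumes fin: "\<And>j. j \<le> n \<Longrightarrow> \<tau> j \<omega> < \<infinity>"
  shows "((\<lambda>t. wealth X n \<tau> \<phi> v t \<omega>) \<longlongrightarrow> terminal_wealth X n \<tau> \<phi> v \<omega>) at_top"
    and "terminal_wealth X n \<tau> \<phi> v \<omega> =
      v + (\<Sum>j<n. \<phi> j \<omega> \<bullet> (at_time X (\<tau> (Suc j) \<omega>) \<omega> - at_time X (\<tau> j \<omega>) \<omega>))"
proof -
  let ?L = "v + (\<Sum>j<n. \<phi> j \<omega> \<bullet> (at_time X (\<tau> (Suc j) \<omega>) \<omega> - at_time X (\<tau> j \<omega>) \<omega>))"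
  have ev: "eventually (\<lambda>t. min (ennreal t) (\<tau> j \<omega>) = \<tau> j \<omega>) at_top" if j: "j \<le> n" for j
    using eventually_ge_at_top[of "enn2real (\<tau> j \<omega>)"]
  proof eventually_elim
    case (elim t)
    then show ?case
      using fin[OF j] by (metis ennreal_enn2real ennreal_leI infinity_ennreal_def min.absorb2)
  qed
  have "eventually (\<lambda>t. \<forall>j\<in>{..n}. min (ennreal t) (\<tau> j \<omega>) = \<tau> j \<omega>) at_top"
    by (rule eventually_ball_finite) (use ev in auto)
  then have "eventually (\<lambda>t. ?L = wealth X n \<tau> \<phi> v t \<omega>) at_top"
    by eventually_elim (auto simp: wealth_def intro!: sum.cong)
  then have lim: "((\<lambda>t. wealth X n \<tau> \<phi> v t \<omega>) \<longlongrightarrow> ?L) at_top"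
    by (rule tendsto_eventually[OF eventually_mono]) simp
  then show eq: "terminal_wealth X n \<tau> \<phi> v \<omega> = ?L"
    unfolding terminal_wealth_def by (intro tendsto_Lim) auto
  show "((\<lambda>t. wealth X n \<tau> \<phi> v t \<omega>) \<longlongrightarrow> terminal_wealth X n \<tau> \<phi> v \<omega>) at_top"
    using lim eq by simp
qed

definition simple_arbitrage ::
    "'a measure \<Rightarrow> (ennreal \<Rightarrow> 'a measure) \<Rightarrow> (real \<Rightarrow> 'a \<Rightarrow> real ^ 'd) \<Rightarrow>
      nat \<Rightarrow> (nat \<Rightarrow> 'a \<Rightarrow> ennreal) \<Rightarrow> (nat \<Rightarrow> 'a \<Rightarrow> real ^ 'd) \<Rightarrow> bool"
  where "simple_arbitrage M F X n \<tau> \<phi> \<longleftrightarrow>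
    simple_strategy M F n \<tau> \<phi> \<and>
    (AE \<omega> in M. terminal_wealth X n \<tau> \<phi> 0 \<omega> \<ge> 0) \<and>
    measure M {\<omega> \<in> space M. terminal_wealth X n \<tau> \<phi> 0 \<omega> > 0} > 0"

text \<open>The infimum is taken in \<^typ>\<open>ereal\<close>, since a path may be unbounded below.\<close>

definition zero_admissible ::
    "'a measure \<Rightarrow> (real \<Rightarrow> 'a \<Rightarrow> real ^ 'd) \<Rightarrow>
      nat \<Rightarrow> (nat \<Rightarrow> 'a \<Rightarrow> ennreal) \<Rightarrow> (nat \<Rightarrow> 'a \<Rightarrow> real ^ 'd) \<Rightarrow> bool"
  where "zero_admissible M X n \<tau> \<phi> \<longleftrightarrow>
    (AE \<omega> in M. (INF t\<in>{0..}. ereal (wealth X n \<tau> \<phi> 0 t \<omega>)) \<ge> 0)"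

text \<open>The strategy \<open>(n, \<rho>, \<phi>)\<close> is, as a process, of the form \<open>H 1\<^bsub>(\<sigma>,\<tau>]\<^esub>\<close>.\<close>

definition one_period_form ::
    "'a measure \<Rightarrow> (ennreal \<Rightarrow> 'a measure) \<Rightarrow>
      nat \<Rightarrow> (nat \<Rightarrow> 'a \<Rightarrow> ennreal) \<Rightarrow> (nat \<Rightarrow> 'a \<Rightarrow> real ^ 'd) \<Rightarrow> bool"
  where "one_period_form M F n \<rho> \<phi> \<longleftrightarrow>
    (\<exists>\<sigma> \<tau> H. bounded_stopping_time M F \<sigma> \<and> bounded_stopping_time M F \<tau> \<and>
      (\<forall>\<omega>\<in>space M. \<sigma> \<omega> \<le> \<tau> \<omega>) \<and> direction M F \<sigma> H \<and>
      (\<forall>\<omega>\<in>space M. \<forall>t\<ge>0.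
        strategy_process n \<rho> \<phi> t \<omega> = indicator {\<sigma> \<omega><..\<tau> \<omega>} (ennreal t) *\<^sub>R H \<omega>))"

end

theory Submission
  imports Defs
begin

text \<open>
  If two-way crossing fails at a bounded stopping time \<open>\<sigma>\<close>, then for some direction \<open>H\<close> and some
  rational \<open>q\<close> the event \<open>\<sigma> \<le> q < \<sigma>\<^bsub>-H\<^esub>\<close>, \<open>H (X\<^sub>q - X\<^sub>\<sigma>) > 0\<close> has positive probability, and holding
  \<open>H\<close> from \<open>\<sigma>\<close> until \<open>\<sigma> \<or> (\<sigma>\<^bsub>-H\<^esub> \<and> q)\<close> is a \<open>0\<close>-admissible arbitrage. Bounded stopping times suffice
  because a finite \<open>\<sigma>\<close> coincides with \<open>\<sigma> \<and> N\<close> on \<open>\<sigma> \<le> N\<close>. Conversely, under two-way crossing a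
  \<open>0\<close>-admissible strategy whose wealth vanishes at \<open>\<tau>\<^sub>j\<close> satisfies \<open>\<phi>\<^sub>j (X - X\<^bsub>\<tau>\<^sub>j\<^esub>) \<ge> 0\<close> up to \<open>\<tau>\<^sub>j\<^sub>+\<^sub>1\<close>,
  so the direction of \<open>-\<phi>\<^sub>j\<close>, and hence also that of \<open>\<phi>\<^sub>j\<close>, is not crossed before \<open>\<tau>\<^sub>j\<^sub>+\<^sub>1\<close>; thus the
  wealth vanishes at \<open>\<tau>\<^sub>j\<^sub>+\<^sub>1\<close> as well.
\<close>

section \<open>Crossing times along a continuous path\<close>

text \<open>Positivity of the gain and lying strictly below \<open>a\<close> both persist on a right
  neighbourhood of a time, so a real witness can be moved to a rational one. The countable
  description serves the measurability of crossing times and the collection of null sets over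
  rational times.\<close>

lemma crossing_time_less_iff:
  assumes cont: "continuous_on {0..} (\<lambda>t. X t \<omega>)"
  shows "crossing_time X \<sigma> H \<omega> < a \<longleftrightarrow>
    (\<exists>q\<in>\<rat>. 0 \<le> q \<and> ennreal q < a \<and> \<sigma> \<omega> \<le> ennreal q \<and> H \<omega> \<bullet> (X q \<omega> - at_time X (\<sigma> \<omega>) \<omega>) > 0)"
    (is "?L \<longleftrightarrow> ?R")
proof
  assume ?L
  then obtain t where t: "0 \<le> t" "ennreal t < a" "\<sigma> \<omega> \<le> ennreal t"
    and pos: "H \<omega> \<bullet> (X t \<omega> - at_time X (\<sigma> \<omega>) \<omega>) > 0"
    by (auto simp: crossing_time_def Inf_less_iff)
  have "((\<lambda>t. X t \<omega>) \<longlongrightarrow> X t \<omega>) (at t within {0..})"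
    using cont t by (simp add: continuous_on_def)
  then have lim: "((\<lambda>t. X t \<omega>) \<longlongrightarrow> X t \<omega>) (at_right t)"
    by (rule tendsto_within_subset) (use t in auto)
  have "((\<lambda>u. H \<omega> \<bullet> (X u \<omega> - at_time X (\<sigma> \<omega>) \<omega>)) \<longlongrightarrow> H \<omega> \<bullet> (X t \<omega> - at_time X (\<sigma> \<omega>) \<omega>)) (at_right t)"
    by (intro tendsto_intros lim)
  then have "eventually (\<lambda>u. H \<omega> \<bullet> (X u \<omega> - at_time X (\<sigma> \<omega>) \<omega>) > 0) (at_right t)"
    using pos by (rule order_tendstoD)
  moreover have "(ennreal \<longlongrightarrow> ennreal t) (at_right t)"
    by (intro tendsto_intros)
  then have "eventually (\<lambda>u. ennreal u < a) (at_right t)"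
    using t(2) by (rule order_tendstoD)
  ultimately have "eventually (\<lambda>u. H \<omega> \<bullet> (X u \<omega> - at_time X (\<sigma> \<omega>) \<omega>) > 0 \<and> ennreal u < a) (at_right t)"
    by (rule eventually_conj)
  then obtain b where b: "t < b" "\<And>u. t < u \<Longrightarrow> u < b \<Longrightarrow>
      H \<omega> \<bullet> (X u \<omega> - at_time X (\<sigma> \<omega>) \<omega>) > 0 \<and> ennreal u < a"
    unfolding eventually_at_right_field by blast
  obtain q where q: "q \<in> \<rat>" "t < q" "q < b"
    using Rats_dense_in_real[OF b(1)] by blast
  moreover have "\<sigma> \<omega> \<le> ennreal q"
    using t(3) q(2) by (meson ennreal_leI less_imp_le order_trans)
  ultimately show ?R
    using b(2)[of q] t(1) by (intro bexI[of _ q]) auto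
next
  assume ?R
  then show ?L
    by (auto simp: crossing_time_def Inf_less_iff)
qed

text \<open>Strictly before the crossing time the gain is nonpositive because the crossing time is
  an infimum; by left-continuity the closed inequality survives at \<open>s\<close> itself, even if
  \<open>s\<close> is the crossing time.\<close>

lemma le_crossing_time_iff:
  assumes cont: "continuous_on {0..} (\<lambda>t. X t \<omega>)"
  shows "ennreal s \<le> crossing_time X \<sigma> H \<omega> \<longleftrightarrow>
    (\<forall>u\<in>{0..s}. \<sigma> \<omega> \<le> ennreal u \<longrightarrow> H \<omega> \<bullet> (X u \<omega> - at_time X (\<sigma> \<omega>) \<omega>) \<le> 0)"
    (is "?L \<longleftrightarrow> ?R")
proof
  assume L: ?L
  let ?f = "\<lambda>u. H \<omega> \<bullet> (X u \<omega> - at_time X (\<sigma> \<omega>) \<omega>)"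
  have before: "?f u \<le> 0" if "0 \<le> u" "u < s" "\<sigma> \<omega> \<le> ennreal u" for u
  proof (rule ccontr)
    assume "\<not> ?f u \<le> 0"
    then have "crossing_time X \<sigma> H \<omega> \<le> ennreal u"
      unfolding crossing_time_def by (intro Inf_lower) (use that in auto)
    moreover have "ennreal u < ennreal s"
      using that by (simp add: ennreal_lessI)
    ultimately show False
      using L by simp
  qed
  have at_s: "?f s \<le> 0" if s: "0 \<le> s" "\<sigma> \<omega> \<le> ennreal s"
  proof -
    define r where "r = enn2real (\<sigma> \<omega>)"
    have r: "\<sigma> \<omega> = ennreal r" "0 \<le> r" "r \<le> s"
      using s by (auto simp: r_def ennreal_enn2real_if top_unique enn2real_leI)
    show ?thesis
    \<comment> \<open>If \<open>s\<close> is the starting time, there is no left limit to take, but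
      then the gain is 0. Otherwise the limit runs over the open interval from \<open>r\<close> to
      \<open>s\<close>.\<close>
    proof (cases "r = s")
      case True
      then show ?thesis
        using r by (simp add: at_time_def)
    next
      case False
      then have "r < s"
        using r by simp
      have "((\<lambda>u. X u \<omega>) \<longlongrightarrow> X s \<omega>) (at s within {0..})"
        using cont s by (simp add: continuous_on_def)
      then have lim: "((\<lambda>u. X u \<omega>) \<longlongrightarrow> X s \<omega>) (at s within {r<..<s})"
        by (rule tendsto_within_subset) (use r in auto)
      have "(?f \<longlongrightarrow> ?f s) (at s within {r<..<s})"
        by (intro tendsto_intros lim)
      moreover have "eventually (\<lambda>u. ?f u \<le> 0) (at s within {r<..<s})"
        unfolding eventually_at_filter
        by (rule always_eventually) (use before r in \<open>auto intro: ennreal_leI\<close>)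
      moreover have "at s within {r<..<s} \<noteq> bot"
        using \<open>r < s\<close> by (simp add: trivial_limit_within islimpt_greaterThanLessThan2)
      ultimately show ?thesis
        by (rule tendsto_upperbound)
    qed
  qed
  show ?R
  proof (intro ballI impI)
    fix u assume "u \<in> {0..s}" "\<sigma> \<omega> \<le> ennreal u"
    then show "?f u \<le> 0"
      using before[of u] at_s by (cases "u = s") auto
  qed
next
  assume R: ?R
  show ?L
    unfolding crossing_time_def
  proof (rule Inf_greatest)
    fix x assume "x \<in> ennreal ` {t. 0 \<le> t \<and> \<sigma> \<omega> \<le> ennreal t \<and> H \<omega> \<bullet> (X t \<omega> - at_time X (\<sigma> \<omega>) \<omega>) > 0}"
    then obtain t where x: "x = ennreal t" and t: "0 \<le> t" "\<sigma> \<omega> \<le> ennreal t" "0 < H \<omega> \<bullet> (X t \<omega> - at_time X (\<sigma> \<omega>) \<omega>)"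
      by auto
    then have "\<not> t \<le> s"
      using R by force
    then show "ennreal s \<le> x"
      unfolding x by (intro ennreal_leI) simp
  qed
qed

section \<open>Measurability at stopping times\<close>

context usual_filtered_prob_space
begin

lemma measurable_F_mono: "s \<le> t \<Longrightarrow> f \<in> measurable (F s) N \<Longrightarrow> f \<in> measurable (F t) N"
  using sets_F_mono[of s t] by (auto simp: measurable_def space_F)

lemma measurable_F_M: "f \<in> measurable (F t) N \<Longrightarrow> f \<in> measurable M N"
  using sets_F_subset[of t] by (auto simp: measurable_def space_F)

lemma measurable_pre_sigma_iff:
  assumes "stopping_time F \<sigma>"
  shows "f \<in> borel_measurable (pre_sigma \<sigma>) \<longleftrightarrow>
    (\<forall>B\<in>sets borel. \<forall>t. {\<omega>\<in>space M. f \<omega> \<in> B \<and> \<sigma> \<omega> \<le> t} \<in> sets (F t))"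
proof -
  have "{\<omega> \<in> f -` B \<inter> space M. \<sigma> \<omega> \<le> t} = {\<omega>\<in>space M. f \<omega> \<in> B \<and> \<sigma> \<omega> \<le> t}" for B t
    by auto
  then show ?thesis
    by (simp add: measurable_def space_pre_sigma sets_pre_sigma[OF assms])
qed

text \<open>Information from time \<sigma> is available at time \<open>t\<close> only where \<sigma>
  \<le> \<open>t\<close>; filling in a constant elsewhere gives a function measurable on the whole
  space at the fixed time \<open>t\<close>.\<close>

lemma measurable_restrict_pre_sigma:
  assumes \<sigma>: "stopping_time F \<sigma>" and f: "f \<in> borel_measurable (pre_sigma \<sigma>)"
  shows "(\<lambda>\<omega>. if \<sigma> \<omega> \<le> t then f \<omega> else c) \<in> borel_measurable (F t)"
proof (rule measurableI)
  fix B :: "'b set" assume B: "B \<in> sets borel"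
  have 1: "{\<omega>\<in>space M. f \<omega> \<in> B \<and> \<sigma> \<omega> \<le> t} \<in> sets (F t)"
    using f B by (simp add: measurable_pre_sigma_iff[OF \<sigma>])
  have 2: "{\<omega>\<in>space M. \<not> \<sigma> \<omega> \<le> t \<and> c \<in> B} \<in> sets (F t)"
    using stopping_timeD2[OF \<sigma>, of t] by (cases "c \<in> B") (simp_all add: pred_def space_F not_le)
  have "(\<lambda>\<omega>. if \<sigma> \<omega> \<le> t then f \<omega> else c) -` B \<inter> space (F t) =
      {\<omega>\<in>space M. f \<omega> \<in> B \<and> \<sigma> \<omega> \<le> t} \<union> {\<omega>\<in>space M. \<not> \<sigma> \<omega> \<le> t \<and> c \<in> B}"
    by (auto simp: space_F split: if_splits)
  then show "(\<lambda>\<omega>. if \<sigma> \<omega> \<le> t then f \<omega> else c) -` B \<inter> space (F t) \<in> sets (F t)"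
    using 1 2 by simp
qed simp

text \<open>For \<open>t\<close> below \<open>N\<close> the condition to check is the one for
  \<sigma>, and from \<open>N\<close> on everything about the truncated function is known. This
  carries a direction at \<sigma> over to the bounded time min(\<sigma>, \<open>N\<close>).\<close>

lemma measurable_pre_sigma_truncate:
  assumes \<sigma>: "stopping_time F \<sigma>" and f: "f \<in> borel_measurable (pre_sigma \<sigma>)"
  shows "(\<lambda>\<omega>. if \<sigma> \<omega> \<le> N then f \<omega> else c) \<in> borel_measurable (pre_sigma (\<lambda>\<omega>. min (\<sigma> \<omega>) N))"
proof -
  let ?g = "\<lambda>\<omega>. if \<sigma> \<omega> \<le> N then f \<omega> else c"
  have st: "stopping_time F (\<lambda>\<omega>. min (\<sigma> \<omega>) N)"
    by (intro stopping_time_min \<sigma> stopping_time_const)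
  have "{\<omega>\<in>space M. ?g \<omega> \<in> B \<and> min (\<sigma> \<omega>) N \<le> t} \<in> sets (F t)" if B: "B \<in> sets borel" for B t
  proof (cases "N \<le> t")
    case True
    then have "{\<omega>\<in>space M. ?g \<omega> \<in> B \<and> min (\<sigma> \<omega>) N \<le> t} = ?g -` B \<inter> space (F t)"
      by (auto simp: space_F min_le_iff_disj)
    moreover have "?g \<in> borel_measurable (F t)"
      using measurable_restrict_pre_sigma[OF \<sigma> f] True by (rule measurable_F_mono[rotated])
    ultimately show ?thesis
      using B by (simp add: measurable_sets)
  next
    case False
    then have "{\<omega>\<in>space M. ?g \<omega> \<in> B \<and> min (\<sigma> \<omega>) N \<le> t} = {\<omega>\<in>space M. f \<omega> \<in> B \<and> \<sigma> \<omega> \<le> t}"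
      by (auto simp: min_le_iff_disj)
    then show ?thesis
      using f B by (simp add: measurable_pre_sigma_iff[OF \<sigma>])
  qed
  then show ?thesis
    by (simp add: measurable_pre_sigma_iff[OF st])
qed

text \<open>Stopping at \<open>s\<close> keeps the sampled value within the information at
  \<open>s\<close>. Where \<sigma> \<le> \<open>s\<close> it is the value of \<open>X\<close> at
  \<sigma>, which is how it enters gains and wealth.\<close>

lemma measurable_at_stopping_time:
  fixes X :: "real \<Rightarrow> 'a \<Rightarrow> 'b::{metric_space, second_countable_topology}"
  assumes ad: "adapted F X" and cont: "continuous_paths M X" and \<sigma>: "stopping_time F \<sigma>" and s: "0 \<le> s"
  shows "(\<lambda>\<omega>. at_time X (min (\<sigma> \<omega>) (ennreal s)) \<omega>) \<in> borel_measurable (F (ennreal s))"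
proof -
  define r where "r \<omega> = enn2real (min (\<sigma> \<omega>) (ennreal s))" for \<omega>
  have r: "0 \<le> r \<omega>" "r \<omega> \<le> s" for \<omega>
    using s by (auto simp: r_def intro: enn2real_leI)
  have [measurable]: "r \<in> borel_measurable (F (ennreal s))"
    unfolding r_def
  proof (intro borel_measurable_enn2real borel_measurableI_le)
    fix y
    show "{\<omega> \<in> space (F (ennreal s)). min (\<sigma> \<omega>) (ennreal s) \<le> y} \<in> sets (F (ennreal s))"
    proof (cases "ennreal s \<le> y")
      case True
      then have "{\<omega> \<in> space (F (ennreal s)). min (\<sigma> \<omega>) (ennreal s) \<le> y} = space (F (ennreal s))"
        by (auto simp: min_le_iff_disj)
      then show ?thesis
        by simp
    next
      case False
      then have "{\<omega> \<in> space (F (ennreal s)). min (\<sigma> \<omega>) (ennreal s) \<le> y} = {\<omega> \<in> space (F (ennreal s)). \<sigma> \<omega> \<le> y}"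
        by (auto simp: min_le_iff_disj)
      then show ?thesis
        using False stopping_time_le_const[OF \<sigma>, of y "ennreal s"] by (auto simp: pred_def)
    qed
  qed
  txt \<open>Rounding \<open>r\<close> down to a dyadic number keeps the sampled values of \<open>X\<close> measurable at time \<open>s\<close>.\<close>
  define k where "k n \<omega> = nat \<lfloor>2 ^ n * r \<omega>\<rfloor>" for n :: nat and \<omega>
  \<comment> \<open>The minimum with \<open>s\<close> does not change the sampled time, since the
    dyadic number is at most \<open>r\<close>. It makes \<open>X\<close> at every grid index
    \<open>i\<close> measurable at time \<open>s\<close>, as the countable composition
    demands.\<close>
  define Y where "Y n \<omega> = X (min (real (k n \<omega>) / 2 ^ n) s) \<omega>" for n \<omega>
  have Y: "Y n \<in> borel_measurable (F (ennreal s))" for n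
    unfolding Y_def
  proof (rule measurable_compose_countable[where g="k n"])
    fix i :: nat
    have "X (min (real i / 2 ^ n) s) \<in> borel_measurable (F (ennreal (min (real i / 2 ^ n) s)))"
      using ad s by (auto simp: adapted_def)
    then show "X (min (real i / 2 ^ n) s) \<in> borel_measurable (F (ennreal s))"
      by (rule measurable_F_mono[rotated]) (simp add: ennreal_leI)
  next
    show "k n \<in> measurable (F (ennreal s)) (count_space UNIV)"
      unfolding k_def by measurable
  qed
  show ?thesis
  proof (rule borel_measurable_LIMSEQ_metric[OF Y])
    fix \<omega> assume "\<omega> \<in> space (F (ennreal s))"
    then have c: "continuous_on {0..} (\<lambda>t. X t \<omega>)"
      using cont by (simp add: continuous_paths_def space_F)
    have kn: "real (k n \<omega>) = of_int \<lfloor>2 ^ n * r \<omega>\<rfloor>" for n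
      using r[of \<omega>] by (simp add: k_def)
    have le: "real (k n \<omega>) / 2 ^ n \<le> r \<omega>" for n
      unfolding kn by (simp add: divide_le_eq mult.commute)
    have ge: "r \<omega> - 1 / 2 ^ n \<le> real (k n \<omega>) / 2 ^ n" for n
    proof -
      have "r \<omega> * 2 ^ n \<le> real (k n \<omega>) + 1"
        unfolding kn using real_of_int_floor_add_one_ge[of "2 ^ n * r \<omega>"] by (simp add: mult.commute)
      then have "r \<omega> \<le> (real (k n \<omega>) + 1) / 2 ^ n"
        by (simp add: le_divide_eq)
      then show ?thesis
        by (simp add: add_divide_distrib)
    qed
    have "(\<lambda>n. real (k n \<omega>) / 2 ^ n) \<longlonglongrightarrow> r \<omega>"
    proof (rule tendsto_sandwich)
      show "\<forall>\<^sub>F n in sequentially. r \<omega> - (1 / 2) ^ n \<le> real (k n \<omega>) / 2 ^ n"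
        using ge by (simp add: power_one_over)
      show "\<forall>\<^sub>F n in sequentially. real (k n \<omega>) / 2 ^ n \<le> r \<omega>"
        using le by simp
      show "(\<lambda>n. r \<omega> - (1 / 2) ^ n) \<longlonglongrightarrow> r \<omega>"
        by (auto intro!: tendsto_eq_intros LIMSEQ_power_zero)
    qed simp
    moreover have "min (real (k n \<omega>) / 2 ^ n) s = real (k n \<omega>) / 2 ^ n" for n
      using le[of n] r(2)[of \<omega>] by simp
    ultimately have "(\<lambda>n. min (real (k n \<omega>) / 2 ^ n) s) \<longlonglongrightarrow> r \<omega>"
      by simp
    then have "(\<lambda>n. Y n \<omega>) \<longlonglongrightarrow> X (r \<omega>) \<omega>"
      unfolding Y_def by (rule continuous_on_tendsto_compose[OF c]) (use r s in auto)
    then show "(\<lambda>n. Y n \<omega>) \<longlonglongrightarrow> at_time X (min (\<sigma> \<omega>) (ennreal s)) \<omega>"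
      by (simp add: at_time_def r_def)
  qed
qed

section \<open>Crossing times are stopping times\<close>

text \<open>For each \<open>s\<close> above a finite \<open>t\<close>, density of the order makes
  the event \<rho> \<le> \<open>t\<close> an intersection of events \<rho> < \<open>u\<close> over
  countably many \<open>u\<close> strictly between \<open>t\<close> and \<open>s\<close>. So it lies
  in \<open>F s\<close>, and right-continuity puts it into \<open>F t\<close>. At infinity the event
  is the whole space.\<close>

lemma stopping_timeI_less:
  assumes "\<And>t. t < \<infinity> \<Longrightarrow> Measurable.pred (F t) (\<lambda>\<omega>. \<rho> \<omega> < t)"
  shows "stopping_time F \<rho>"
proof
  fix t :: ennreal
  show "Measurable.pred (F t) (\<lambda>\<omega>. \<rho> \<omega> \<le> t)"
  proof (cases "t = \<infinity>")
    case False
    then have "t < \<infinity>"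
      by (simp add: less_top)
    have "{\<omega>\<in>space M. \<rho> \<omega> \<le> t} \<in> sets (F s)" if "t < s" for s
    proof -
      obtain D :: "ennreal set"
        where D: "countable D" "\<And>U. open U \<Longrightarrow> U \<noteq> {} \<Longrightarrow> \<exists>d\<in>D. d \<in> U"
        using countable_dense_setE by auto
      let ?D = "{u\<in>D. t < u \<and> u < s}"
      have "\<rho> \<omega> \<le> t \<longleftrightarrow> (\<forall>u\<in>?D. \<rho> \<omega> < u)" for \<omega>
      proof
        assume *: "\<forall>u\<in>?D. \<rho> \<omega> < u"
        show "\<rho> \<omega> \<le> t"
        proof (rule ccontr)
          assume "\<not> \<rho> \<omega> \<le> t"
          then have "t < min (\<rho> \<omega>) s"
            using that by simp
          then have "{t<..<min (\<rho> \<omega>) s} \<noteq> {}"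
            by (simp only: greaterThanLessThan_empty_iff not_le not_False_eq_True)
          then show False
            using D(2)[OF open_greaterThanLessThan] * by fastforce
        qed
      qed (auto intro: order_le_less_trans)
      moreover have "Measurable.pred (F s) (\<lambda>\<omega>. \<rho> \<omega> < u)" if "u \<in> ?D" for u
      proof -
        have "u < \<infinity>"
          using that by (auto intro: order_less_le_trans)
        then show ?thesis
          using assms[of u] that by (intro measurable_F_mono[of u s]) auto
      qed
      then have "Measurable.pred (F s) (\<lambda>\<omega>. \<forall>u\<in>?D. \<rho> \<omega> < u)"
        by (intro measurable_pred_countable countable_Collect D)
      ultimately show ?thesis
        by (simp add: pred_def space_F)
    qed
    then show ?thesis
      using right_continuous_F[OF \<open>t < \<infinity>\<close>] by (simp add: pred_def space_F)
  qed simp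
qed

text \<open>Whether the crossing happens strictly before \<open>t\<close> is decided by countably
  many rational times below \<open>t\<close>. An entry into an open half-space is only visible
  immediately afterwards, which is why the strict criterion is used.\<close>

lemma stopping_time_crossing_time:
  assumes ad: "adapted F X" and cont: "continuous_paths M X" and \<sigma>: "stopping_time F \<sigma>"
    and H: "H \<in> borel_measurable (pre_sigma \<sigma>)"
  shows "stopping_time F (crossing_time X \<sigma> H)"
proof (rule stopping_timeI_less)
  fix t :: ennreal
  let ?P = "\<lambda>q \<omega>. \<sigma> \<omega> \<le> ennreal q \<and> H \<omega> \<bullet> (X q \<omega> - at_time X (\<sigma> \<omega>) \<omega>) > 0"
  \<comment> \<open>The same event, written with the restricted \<open>H\<close> and the stopped
    value of \<open>X\<close>, so that each ingredient is measurable at time \<open>q\<close> on the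
    whole space.\<close>
  let ?Q = "\<lambda>q \<omega>. (if \<sigma> \<omega> \<le> ennreal q then H \<omega> else 0) \<bullet>
    (X q \<omega> - at_time X (min (\<sigma> \<omega>) (ennreal q)) \<omega>) > 0"
  have PQ: "?P q \<omega> \<longleftrightarrow> ?Q q \<omega>" for q \<omega>
    by (simp add: min_def)
  have "Measurable.pred (F t) (?P q)" if q: "0 \<le> q" "ennreal q < t" for q
  proof -
    have [measurable]: "X q \<in> borel_measurable (F (ennreal q))"
      using ad q by (simp add: adapted_def)
    note [measurable] = measurable_at_stopping_time[OF ad cont \<sigma> q(1)]
      measurable_restrict_pre_sigma[OF \<sigma> H, of "ennreal q" 0]
    have "Measurable.pred (F (ennreal q)) (?Q q)"
      by measurable
    then show ?thesis
      unfolding PQ by (rule measurable_F_mono[rotated]) (use q in simp)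
  qed
  then have "Measurable.pred (F t) (\<lambda>\<omega>. \<exists>q\<in>{q\<in>\<rat>. 0 \<le> q \<and> ennreal q < t}. ?P q \<omega>)"
    by (intro measurable_pred_countable countable_Collect countable_rat) auto
  then show "Measurable.pred (F t) (\<lambda>\<omega>. crossing_time X \<sigma> H \<omega> < t)"
    by (rule measurable_cong[THEN iffD2, rotated])
      (use cont in \<open>auto simp: space_F continuous_paths_def crossing_time_less_iff\<close>)
qed

section \<open>Two-way crossing at finite and at bounded stopping times\<close>

lemma TWC_finite_imp_bounded: "TWC_finite M F X \<Longrightarrow> TWC_bounded M F X"
  unfolding TWC_finite_def TWC_bounded_def
proof (intro allI impI)
  fix \<sigma> assume *: "\<forall>\<sigma>. finite_stopping_time M F \<sigma> \<longrightarrow> two_way_crossing_at M F X \<sigma>"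
    and "bounded_stopping_time M F \<sigma>"
  then have "finite_stopping_time M F \<sigma>"
    by (auto simp: bounded_stopping_time_def finite_stopping_time_def
        dest: order_le_less_trans[OF _ ennreal_less_top])
  with * show "two_way_crossing_at M F X \<sigma>"
    by blast
qed

lemma TWC_bounded_imp_finite:
  fixes X :: "real \<Rightarrow> 'a \<Rightarrow> real ^ 'd"
  assumes TWC: "TWC_bounded M F X"
  shows "TWC_finite M F X"
  unfolding TWC_finite_def two_way_crossing_at_def
proof (intro allI impI)
  fix \<sigma> and H :: "'a \<Rightarrow> real ^ 'd"
  assume fin: "finite_stopping_time M F \<sigma>" and dir: "direction M F \<sigma> H"
  then have \<sigma>: "stopping_time F \<sigma>" and \<sigma>_fin: "AE \<omega> in M. \<sigma> \<omega> < \<infinity>"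
    and H: "H \<in> borel_measurable (pre_sigma \<sigma>)" and H1: "AE \<omega> in M. norm (H \<omega>) = 1"
    by (auto simp: finite_stopping_time_def direction_def)
  \<comment> \<open>An arbitrary unit vector: the truncated \<open>H\<close> must have norm 1 also
    where \<sigma> exceeds \<open>N\<close>.\<close>
  define e :: "real ^ 'd" where "e = axis undefined 1"
  define S where "S N \<omega> = min (\<sigma> \<omega>) (of_nat N)" for N \<omega>
  define G where "G N \<omega> = (if \<sigma> \<omega> \<le> of_nat N then H \<omega> else e)" for N \<omega>
  have "AE \<omega> in M. crossing_time X (S N) (G N) \<omega> = crossing_time X (S N) (\<lambda>\<omega>. - G N \<omega>) \<omega>" for N
  proof -
    have "bounded_stopping_time M F (S N)"
      unfolding bounded_stopping_time_def S_def
      by (auto intro!: stopping_time_min \<sigma> stopping_time_const exI[of _ "real N"]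
          simp: ennreal_of_nat_eq_real_of_nat)
    moreover have "direction M F (S N) (G N)"
      unfolding direction_def S_def G_def
      using measurable_pre_sigma_truncate[OF \<sigma> H] H1 by (auto simp: e_def)
    ultimately show ?thesis
      using TWC by (auto simp: TWC_bounded_def two_way_crossing_at_def)
  qed
  then have "AE \<omega> in M. \<forall>N. crossing_time X (S N) (G N) \<omega> = crossing_time X (S N) (\<lambda>\<omega>. - G N \<omega>) \<omega>"
    by (simp add: AE_all_countable)
  then show "AE \<omega> in M. crossing_time X \<sigma> H \<omega> = crossing_time X \<sigma> (\<lambda>\<omega>. - H \<omega>) \<omega>"
    using \<sigma>_fin
  proof eventually_elim
    case (elim \<omega>)
    obtain N :: nat where "\<sigma> \<omega> < of_nat N"
      using elim(2) ennreal_Ex_less_of_nat by auto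
    then have "S N \<omega> = \<sigma> \<omega>" "G N \<omega> = H \<omega>"
      by (auto simp: S_def G_def)
    \<comment> \<open>A crossing time at \<omega> depends on the stopping time and the direction
      only through their values at \<omega>.\<close>
    then show ?case
      using elim(1)[rule_format, of N] by (simp add: crossing_time_def)
  qed
qed

section \<open>From a one-sided crossing to a one-period arbitrage\<close>

text \<open>As long as \<open>-H\<close> is not crossed, the gain from holding \<open>H\<close>
  cannot be negative; closing the position at \<open>q\<close> secures the positive gain on the
  given non-null event.\<close>

lemma one_sided_crossing_imp_one_period_arbitrage:
  fixes X :: "real \<Rightarrow> 'a \<Rightarrow> real ^ 'd"
  assumes ad: "adapted F X" and cont: "continuous_paths M X"
    and \<sigma>: "bounded_stopping_time M F \<sigma>" and dir: "direction M F \<sigma> H" and q: "0 \<le> q"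
    and nonnull: "\<not> (AE \<omega> in M. \<not> (ennreal q < crossing_time X \<sigma> (\<lambda>\<omega>. - H \<omega>) \<omega> \<and>
      \<sigma> \<omega> \<le> ennreal q \<and> H \<omega> \<bullet> (X q \<omega> - at_time X (\<sigma> \<omega>) \<omega>) > 0))"
  shows "\<exists>n \<tau> \<phi>. simple_arbitrage M F X n \<tau> \<phi> \<and> zero_admissible M X n \<tau> \<phi> \<and>
    one_period_form M F n \<tau> \<phi>"
proof -
  obtain c where st: "stopping_time F \<sigma>" and c: "\<And>\<omega>. \<omega> \<in> space M \<Longrightarrow> \<sigma> \<omega> \<le> ennreal c"
    using \<sigma> by (auto simp: bounded_stopping_time_def)
  have H: "H \<in> borel_measurable (pre_sigma \<sigma>)"
    using dir by (simp add: direction_def)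
  define \<rho> where "\<rho> = crossing_time X \<sigma> (\<lambda>\<omega>. - H \<omega>)"
  \<comment> \<open>The minimum with \<open>q\<close> stops at the profitable time and keeps \<tau>
    bounded. The maximum matters only where \<sigma> exceeds \<open>q\<close>; there \<tau> equals
    \<sigma> and nothing is traded.\<close>
  define \<tau> where "\<tau> \<omega> = max (\<sigma> \<omega>) (min (\<rho> \<omega>) (ennreal q))" for \<omega>
  \<comment> \<open>A common deterministic bound for \<sigma> and \<tau>; the 0 guards against a
    negative \<open>c\<close>.\<close>
  define d where "d = max 0 (max c q)"
  have d: "0 \<le> d"
    by (simp add: d_def)
  have st_\<tau>: "stopping_time F \<tau>"
    unfolding \<tau>_def \<rho>_def using H
    by (intro stopping_time_max stopping_time_min stopping_time_const st
        stopping_time_crossing_time[OF ad cont] borel_measurable_uminus)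
  have \<sigma>_le: "\<sigma> \<omega> \<le> ennreal d" and \<tau>_le: "\<tau> \<omega> \<le> ennreal d" if "\<omega> \<in> space M" for \<omega>
  proof -
    have "ennreal c \<le> ennreal d" "ennreal q \<le> ennreal d"
      by (simp_all add: d_def ennreal_leI)
    then show "\<sigma> \<omega> \<le> ennreal d" "\<tau> \<omega> \<le> ennreal d"
      using c[OF that] by (auto simp: \<tau>_def min_le_iff_disj)
  qed
  have bdd_\<tau>: "bounded_stopping_time M F \<tau>"
    using st_\<tau> \<tau>_le by (auto simp: bounded_stopping_time_def)
  have \<sigma>_\<tau>: "\<sigma> \<omega> \<le> \<tau> \<omega>" for \<omega>
    by (simp add: \<tau>_def)
  \<comment> \<open>A simple strategy must start at time 0, so an idle period up to \<sigma> comes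
    first. Its zero holding also removes the term at time 0 from the strategy process.\<close>
  define T where "T j = (if j = 0 then \<lambda>_. 0 else if j = 1 then \<sigma> else \<tau>)" for j :: nat
  define \<phi> where "\<phi> j = (if j = 0 then \<lambda>_. 0 else H)" for j :: nat
  have T_less: "T j \<omega> < \<infinity>" if "\<omega> \<in> space M" for j \<omega>
    using \<sigma>_le[OF that] \<tau>_le[OF that] by (auto simp: T_def intro: order_le_less_trans)
  have strat: "simple_strategy M F 2 T \<phi>"
    unfolding simple_strategy_def finite_stopping_time_def
    using st st_\<tau> H \<sigma>_\<tau> T_less
    by (auto simp: T_def \<phi>_def stopping_time_const less_2_cases_iff)
  have wealth: "wealth X 2 T \<phi> 0 t \<omega> =
      H \<omega> \<bullet> (at_time X (min (ennreal t) (\<tau> \<omega>)) \<omega> - at_time X (min (ennreal t) (\<sigma> \<omega>)) \<omega>)" for t \<omega>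
    by (simp add: wealth_def T_def \<phi>_def numeral_2_eq_2)
  have terminal: "terminal_wealth X 2 T \<phi> 0 \<omega> = H \<omega> \<bullet> (at_time X (\<tau> \<omega>) \<omega> - at_time X (\<sigma> \<omega>) \<omega>)"
    if "\<omega> \<in> space M" for \<omega>
    using terminal_wealth_eq(2)[of 2 T \<omega> X \<phi> 0] T_less[OF that]
    by (simp add: T_def \<phi>_def numeral_2_eq_2)
  have wealth_nonneg: "0 \<le> wealth X 2 T \<phi> 0 t \<omega>" if \<omega>: "\<omega> \<in> space M" and t: "0 \<le> t" for t \<omega>
  proof (cases "ennreal t \<le> \<sigma> \<omega> \<or> \<tau> \<omega> = \<sigma> \<omega>")
    case True
    then show ?thesis
      using \<sigma>_\<tau>[of \<omega>] by (auto simp: wealth min_def dest: order_trans)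
  next
    case False
    define s where "s = enn2real (min (ennreal t) (\<tau> \<omega>))"
    have s: "0 \<le> s" "ennreal s = min (ennreal t) (\<tau> \<omega>)"
      by (simp_all add: s_def ennreal_enn2real_if min_def top_unique)
    \<comment> \<open>Since \<tau> differs from \<sigma>, the maximum defining \<tau> is attained by
      min(\<rho>, \<open>q\<close>).\<close>
    have "\<tau> \<omega> \<le> \<rho> \<omega>"
      using False by (auto simp: \<tau>_def max_def split: if_splits)
    then have "ennreal s \<le> \<rho> \<omega>" and "\<sigma> \<omega> \<le> ennreal s"
      using False \<sigma>_\<tau>[of \<omega>] by (auto simp: s min_le_iff_disj)
    moreover have "continuous_on {0..} (\<lambda>t. X t \<omega>)"
      using cont \<omega> by (simp add: continuous_paths_def)
    ultimately have "0 \<le> H \<omega> \<bullet> (X s \<omega> - at_time X (\<sigma> \<omega>) \<omega>)"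
      using s(1) by (auto simp: \<rho>_def le_crossing_time_iff)
    moreover have "min (ennreal t) (\<sigma> \<omega>) = \<sigma> \<omega>"
      using False by (simp add: min_def)
    ultimately show ?thesis
      by (simp add: wealth at_time_def s_def)
  qed
  have adm: "zero_admissible M X 2 T \<phi>"
    unfolding zero_admissible_def
    by (intro AE_I2 INF_greatest) (use wealth_nonneg in simp)
  \<comment> \<open>Both stopping times are bounded by \<open>d\<close>, so terminal wealth is
    already reached at time \<open>d\<close>.\<close>
  have term_nonneg: "0 \<le> terminal_wealth X 2 T \<phi> 0 \<omega>" if \<omega>: "\<omega> \<in> space M" for \<omega>
    using wealth_nonneg[OF \<omega> d] \<sigma>_le[OF \<omega>] \<tau>_le[OF \<omega>] by (simp add: terminal[OF \<omega>] wealth)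
  have "measure M {\<omega> \<in> space M. terminal_wealth X 2 T \<phi> 0 \<omega> > 0} > 0" (is "measure M ?A > 0")
  proof -
    \<comment> \<open>This is the terminal wealth on \<open>space M\<close>, where the truncations
      at \<open>d\<close> have no effect; in this form it is measurable at time
      \<open>d\<close>.\<close>
    have "(\<lambda>\<omega>. (if \<sigma> \<omega> \<le> ennreal d then H \<omega> else 0) \<bullet>
        (at_time X (min (\<tau> \<omega>) (ennreal d)) \<omega> - at_time X (min (\<sigma> \<omega>) (ennreal d)) \<omega>)) \<in> borel_measurable M"
      by (intro borel_measurable_inner borel_measurable_diff measurable_F_M[where t="ennreal d"]
          measurable_restrict_pre_sigma[OF st H]
          measurable_at_stopping_time[OF ad cont _ d] st st_\<tau>)
    then have [measurable]: "terminal_wealth X 2 T \<phi> 0 \<in> borel_measurable M"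
      by (rule measurable_cong[THEN iffD1, rotated]) (simp add: terminal \<sigma>_le \<tau>_le)
    have A: "?A \<in> sets M"
      by measurable
    have "emeasure M ?A \<noteq> 0"
    proof
      assume "emeasure M ?A = 0"
      then have "AE \<omega> in M. \<not> terminal_wealth X 2 T \<phi> 0 \<omega> > 0"
        using A by (subst AE_iff_measurable[OF A]) auto
      then have "AE \<omega> in M. \<not> (ennreal q < \<rho> \<omega> \<and>
          \<sigma> \<omega> \<le> ennreal q \<and> H \<omega> \<bullet> (X q \<omega> - at_time X (\<sigma> \<omega>) \<omega>) > 0)"
        using AE_space
      proof eventually_elim
        case (elim \<omega>)
        show ?case
        proof safe
          assume *: "ennreal q < \<rho> \<omega>" "\<sigma> \<omega> \<le> ennreal q" "H \<omega> \<bullet> (X q \<omega> - at_time X (\<sigma> \<omega>) \<omega>) > 0"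
          then have "\<tau> \<omega> = ennreal q"
            by (simp add: \<tau>_def)
          with * elim q show False
            by (simp add: terminal at_time_def)
        qed
      qed
      with nonnull show False
        by (simp add: \<rho>_def)
    qed
    then show ?thesis
      by (simp add: emeasure_eq_measure zero_less_measure_iff)
  qed
  then have "simple_arbitrage M F X 2 T \<phi>"
    unfolding simple_arbitrage_def using strat term_nonneg by auto
  moreover have "one_period_form M F 2 T \<phi>"
    unfolding one_period_form_def
  proof (intro exI conjI ballI allI impI)
    show "strategy_process 2 T \<phi> t \<omega> = indicator {\<sigma> \<omega><..\<tau> \<omega>} (ennreal t) *\<^sub>R H \<omega>" for t \<omega>
      by (simp add: strategy_process_def T_def \<phi>_def numeral_2_eq_2)
  qed (use \<sigma> bdd_\<tau> \<sigma>_\<tau> dir in auto)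
  ultimately show ?thesis
    using adm by blast
qed

text \<open>Without arbitrage the one-sided event is null for every rational \<open>q\<close>, so no
  direction is crossed strictly before its negative. Applying this to \<open>H\<close> and to
  \<open>-H\<close> gives equality.\<close>

lemma no_one_period_arbitrage_imp_TWC_bounded:
  fixes X :: "real \<Rightarrow> 'a \<Rightarrow> real ^ 'd"
  assumes ad: "adapted F X" and cont: "continuous_paths M X"
    and no: "\<not> (\<exists>n \<tau> \<phi>. simple_arbitrage M F X n \<tau> \<phi> \<and> zero_admissible M X n \<tau> \<phi> \<and>
      one_period_form M F n \<tau> \<phi>)"
  shows "TWC_bounded M F X"
  unfolding TWC_bounded_def two_way_crossing_at_def
proof (intro allI impI)
  fix \<sigma> and H :: "'a \<Rightarrow> real ^ 'd"
  assume \<sigma>: "bounded_stopping_time M F \<sigma>" and dir: "direction M F \<sigma> H"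
  have ge: "AE \<omega> in M. crossing_time X \<sigma> (\<lambda>\<omega>. - G \<omega>) \<omega> \<le> crossing_time X \<sigma> G \<omega>"
    if G: "direction M F \<sigma> G" for G
  proof -
    have "AE \<omega> in M. \<not> (ennreal q < crossing_time X \<sigma> (\<lambda>\<omega>. - G \<omega>) \<omega> \<and>
        \<sigma> \<omega> \<le> ennreal q \<and> G \<omega> \<bullet> (X q \<omega> - at_time X (\<sigma> \<omega>) \<omega>) > 0)" if "0 \<le> q" for q
      using one_sided_crossing_imp_one_period_arbitrage[OF ad cont \<sigma> G that] no by blast
    then have "AE \<omega> in M. \<forall>q\<in>{q\<in>\<rat>. 0 \<le> q}. \<not> (ennreal q < crossing_time X \<sigma> (\<lambda>\<omega>. - G \<omega>) \<omega> \<and>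
        \<sigma> \<omega> \<le> ennreal q \<and> G \<omega> \<bullet> (X q \<omega> - at_time X (\<sigma> \<omega>) \<omega>) > 0)"
      by (intro AE_ball_countable[THEN iffD2] countable_Collect countable_rat) auto
    then show ?thesis
      using AE_space
    proof eventually_elim
      case (elim \<omega>)
      then have c: "continuous_on {0..} (\<lambda>t. X t \<omega>)"
        using cont by (simp add: continuous_paths_def)
      show ?case
        \<comment> \<open>If \<open>G\<close> were crossed before \<open>-G\<close>, a rational
          \<open>q\<close> below the crossing time of \<open>-G\<close> would witness it, in
          contradiction to the excluded event.\<close>
        using elim(1) by (subst not_less[symmetric]) (auto simp: crossing_time_less_iff[of X \<omega>, OF c])
    qed
  qed
  have "direction M F \<sigma> (\<lambda>\<omega>. - H \<omega>)"
    using dir by (auto simp: direction_def)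
  from ge[OF this] ge[OF dir]
  show "AE \<omega> in M. crossing_time X \<sigma> H \<omega> = crossing_time X \<sigma> (\<lambda>\<omega>. - H \<omega>) \<omega>"
    by eventually_elim simp
qed

section \<open>Two-way crossing excludes simple arbitrage\<close>

lemma TWC_finite_imp_terminal_wealth_eq_0:
  fixes X :: "real \<Rightarrow> 'a \<Rightarrow> real ^ 'd"
  assumes cont: "continuous_paths M X" and TWC: "TWC_finite M F X"
    and strat: "simple_strategy M F n \<tau> \<phi>" and adm: "zero_admissible M X n \<tau> \<phi>"
  shows "AE \<omega> in M. terminal_wealth X n \<tau> \<phi> 0 \<omega> = 0"
proof -
  \<comment> \<open>The wealth accumulated up to the \<open>m\<close>-th trading date; it vanishes
    almost surely by induction on the date, and \<open>S n\<close> is the terminal wealth.\<close>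
  define S where "S m \<omega> = (\<Sum>i<m. \<phi> i \<omega> \<bullet> (at_time X (\<tau> (Suc i) \<omega>) \<omega> - at_time X (\<tau> i \<omega>) \<omega>))" for m \<omega>
  have "AE \<omega> in M. \<forall>j\<in>{..n}. \<tau> j \<omega> < \<infinity>"
    using strat by (intro AE_finite_allI) (auto simp: simple_strategy_def finite_stopping_time_def)
  then have fin: "AE \<omega> in M. \<forall>j\<le>n. \<tau> j \<omega> < \<infinity>"
    by eventually_elim simp
  have mono: "\<tau> i \<omega> \<le> \<tau> j \<omega>" if "i \<le> j" "j \<le> n" "\<omega> \<in> space M" for i j \<omega>
    using that
  proof (induction j rule: dec_induct)
    case (step m)
    then have "\<tau> m \<omega> \<le> \<tau> (Suc m) \<omega>"
      using strat by (simp add: simple_strategy_def)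
    with step show ?case
      by (auto intro: order_trans)
  qed simp
  \<comment> \<open>During period \<open>j\<close> later periods contribute nothing, as both their
    endpoints are cut to \<open>t\<close>, while earlier periods are complete and add up to
    \<open>S j\<close>.\<close>
  have wealth: "wealth X n \<tau> \<phi> 0 t \<omega> = S j \<omega> + \<phi> j \<omega> \<bullet> (X t \<omega> - at_time X (\<tau> j \<omega>) \<omega>)"
    if "j < n" "\<omega> \<in> space M" "0 \<le> t" "\<tau> j \<omega> \<le> ennreal t" "ennreal t \<le> \<tau> (Suc j) \<omega>" for j t \<omega>
  proof -
    let ?g = "\<lambda>i. \<phi> i \<omega> \<bullet> (at_time X (min (ennreal t) (\<tau> (Suc i) \<omega>)) \<omega> - at_time X (min (ennreal t) (\<tau> i \<omega>)) \<omega>)"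
    have "(\<Sum>i<n. ?g i) = (\<Sum>i<Suc j. ?g i)"
    proof (rule sum.mono_neutral_right)
      show "\<forall>i\<in>{..<n} - {..<Suc j}. ?g i = 0"
      proof
        fix i assume "i \<in> {..<n} - {..<Suc j}"
        then have "ennreal t \<le> \<tau> i \<omega>" "ennreal t \<le> \<tau> (Suc i) \<omega>"
          using that mono[of "Suc j" i \<omega>] mono[of "Suc j" "Suc i" \<omega>] by auto
        then show "?g i = 0"
          by (simp add: min_def)
      qed
    qed (use that in auto)
    also have "\<dots> = (\<Sum>i<j. ?g i) + ?g j"
      by simp
    also have "(\<Sum>i<j. ?g i) = S j \<omega>"
      unfolding S_def
    proof (rule sum.cong)
      fix i assume "i \<in> {..<j}"
      then have "\<tau> i \<omega> \<le> ennreal t" "\<tau> (Suc i) \<omega> \<le> ennreal t"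
        using that mono[of i j \<omega>] mono[of "Suc i" j \<omega>] by auto
      then show "?g i = \<phi> i \<omega> \<bullet> (at_time X (\<tau> (Suc i) \<omega>) \<omega> - at_time X (\<tau> i \<omega>) \<omega>)"
        by (simp add: min_def antisym)
    qed simp
    also have "?g j = \<phi> j \<omega> \<bullet> (X t \<omega> - at_time X (\<tau> j \<omega>) \<omega>)"
      using that by (simp add: min_absorb1 min_absorb2) (simp add: at_time_def)
    finally show ?thesis
      by (simp add: wealth_def)
  qed
  have "AE \<omega> in M. S j \<omega> = 0" if "j \<le> n" for j
    using that
  proof (induction j)
    case 0
    then show ?case
      by (simp add: S_def)
  next
    case (Suc j)
    \<comment> \<open>Normalizing the holding yields a direction. Where the holding is zero any unit
      vector will do, because the increment of \<open>S\<close> vanishes there anyway.\<close>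
    define H where "H \<omega> = (if \<phi> j \<omega> = 0 then axis undefined 1 else \<phi> j \<omega> /\<^sub>R norm (\<phi> j \<omega>))" for \<omega>
    have [measurable]: "\<phi> j \<in> borel_measurable (pre_sigma (\<tau> j))"
      and st: "finite_stopping_time M F (\<tau> j)"
      using strat Suc.prems by (auto simp: simple_strategy_def)
    have "direction M F (\<tau> j) H"
      unfolding direction_def
    proof
      show "H \<in> borel_measurable (pre_sigma (\<tau> j))"
        unfolding H_def by measurable
    qed (simp add: H_def)
    with TWC st have "AE \<omega> in M. crossing_time X (\<tau> j) H \<omega> = crossing_time X (\<tau> j) (\<lambda>\<omega>. - H \<omega>) \<omega>"
      by (auto simp: TWC_finite_def two_way_crossing_at_def)
    moreover have "AE \<omega> in M. S j \<omega> = 0"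
      using Suc by simp
    ultimately show ?case
      using fin adm[unfolded zero_admissible_def] AE_space
    proof eventually_elim
      case (elim \<omega>)
      have c: "continuous_on {0..} (\<lambda>t. X t \<omega>)"
        using cont elim by (simp add: continuous_paths_def)
      define s where "s = enn2real (\<tau> (Suc j) \<omega>)"
      have s: "0 \<le> s" "ennreal s = \<tau> (Suc j) \<omega>"
        using elim(3) Suc.prems by (auto simp: s_def)
      have le: "\<tau> j \<omega> \<le> ennreal s"
        using mono[of j "Suc j" \<omega>] Suc.prems elim by (simp add: s)
      show ?case
      proof (cases "\<phi> j \<omega> = 0")
        case True
        then show ?thesis
          using elim by (simp add: S_def)
      next
        case False
        \<comment> \<open>Wealth starts the period at \<open>S j\<close> = 0, so admissibility
          bounds the gain of the period itself from below.\<close>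
        have "0 \<le> H \<omega> \<bullet> (X u \<omega> - at_time X (\<tau> j \<omega>) \<omega>)" if u: "u \<in> {0..s}" "\<tau> j \<omega> \<le> ennreal u" for u
        proof -
          have "0 \<le> ereal (wealth X n \<tau> \<phi> 0 u \<omega>)"
            using elim(4) u by (auto simp: le_INF_iff)
          then have "0 \<le> \<phi> j \<omega> \<bullet> (X u \<omega> - at_time X (\<tau> j \<omega>) \<omega>)"
            using wealth[of j \<omega> u] elim u Suc.prems by (simp add: s(2)[symmetric] ennreal_leI)
          then show ?thesis
            using False by (simp add: H_def)
        qed
        then have "ennreal s \<le> crossing_time X (\<tau> j) (\<lambda>\<omega>. - H \<omega>) \<omega>"
          by (simp add: le_crossing_time_iff[of X \<omega>, OF c])
        \<comment> \<open>Two-way crossing transfers the absence of a crossing before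
          \<open>s\<close> from \<open>-H\<close> to \<open>H\<close>.\<close>
        then have "ennreal s \<le> crossing_time X (\<tau> j) H \<omega>"
          using elim by simp
        then have "H \<omega> \<bullet> (X s \<omega> - at_time X (\<tau> j \<omega>) \<omega>) \<le> 0"
          using s(1) le by (simp add: le_crossing_time_iff[of X \<omega>, OF c])
        then have "\<phi> j \<omega> \<bullet> (X s \<omega> - at_time X (\<tau> j \<omega>) \<omega>) \<le> 0"
          using False by (simp add: H_def mult_le_0_iff)
        \<comment> \<open>Admissibility at time \<open>s\<close> supplies the opposite inequality,
          so the increment over the period is exactly 0.\<close>
        moreover have "0 \<le> wealth X n \<tau> \<phi> 0 s \<omega>"
          using elim(4) s by (auto simp: le_INF_iff)
        then have "0 \<le> \<phi> j \<omega> \<bullet> (X s \<omega> - at_time X (\<tau> j \<omega>) \<omega>)"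
          using wealth[of j \<omega> s] elim s le Suc.prems by simp
        ultimately show ?thesis
          using elim(2) by (simp add: S_def at_time_def s_def)
      qed
    qed
  qed
  from this[OF order_refl] fin show ?thesis
  proof eventually_elim
    case (elim \<omega>)
    then show ?case
      using terminal_wealth_eq(2)[of n \<tau> \<omega> X \<phi> 0] by (simp add: S_def)
  qed
qed

lemma TWC_finite_imp_no_simple_arbitrage:
  fixes X :: "real \<Rightarrow> 'a \<Rightarrow> real ^ 'd"
  assumes "continuous_paths M X" and "TWC_finite M F X"
  shows "\<not> (simple_arbitrage M F X n \<tau> \<phi> \<and> zero_admissible M X n \<tau> \<phi>)"
proof
  assume *: "simple_arbitrage M F X n \<tau> \<phi> \<and> zero_admissible M X n \<tau> \<phi>"
  with assms have "AE \<omega> in M. terminal_wealth X n \<tau> \<phi> 0 \<omega> = 0"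
    by (intro TWC_finite_imp_terminal_wealth_eq_0) (auto simp: simple_arbitrage_def)
  then have "AE \<omega> in M. \<not> terminal_wealth X n \<tau> \<phi> 0 \<omega> > 0"
    by eventually_elim simp
  \<comment> \<open>Completeness of \<open>M\<close> makes the exceptional set itself a null set, in
    particular measurable.\<close>
  then have "{\<omega> \<in> space M. terminal_wealth X n \<tau> \<phi> 0 \<omega> > 0} \<in> null_sets M"
    by (simp add: AE_iff_null_sets)
  then have "measure M {\<omega> \<in> space M. terminal_wealth X n \<tau> \<phi> 0 \<omega> > 0} = 0"
    by (rule measure_eq_0_null_sets)
  with * show False
    by (simp add: simple_arbitrage_def)
qed

end

theorem proposition3p3:
  fixes M :: "'a measure" and F :: "ennreal \<Rightarrow> 'a measure" and X :: "real \<Rightarrow> 'a \<Rightarrow> real ^ 'd"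
  assumes "usual_filtered_prob_space M F"
    and "adapted F X"
    and "continuous_paths M X"
  shows "(TWC_finite M F X \<longleftrightarrow> TWC_bounded M F X) \<and>
    (TWC_bounded M F X \<longleftrightarrow>
      \<not> (\<exists>n \<tau> \<phi>. simple_arbitrage M F X n \<tau> \<phi> \<and> zero_admissible M X n \<tau> \<phi> \<and>
        one_period_form M F n \<tau> \<phi>)) \<and>
    (\<not> (\<exists>n \<tau> \<phi>. simple_arbitrage M F X n \<tau> \<phi> \<and> zero_admissible M X n \<tau> \<phi> \<and>
        one_period_form M F n \<tau> \<phi>) \<longleftrightarrow>
      \<not> (\<exists>n \<tau> \<phi>. simple_arbitrage M F X n \<tau> \<phi> \<and> zero_admissible M X n \<tau> \<phi>))"
proof -
  interpret usual_filtered_prob_space M F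
    by fact
  \<comment> \<open>The cycle closes because excluding all \<open>0\<close>-admissible simple
    arbitrages excludes in particular those of one-period form.\<close>
  show ?thesis
    using TWC_finite_imp_bounded[of X] TWC_bounded_imp_finite[of X]
      no_one_period_arbitrage_imp_TWC_bounded[OF assms(2,3)]
      TWC_finite_imp_no_simple_arbitrage[OF assms(3)] by blast
qed

end
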